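(* Let $X$ be a separable Banach space such that every countable complete metric space bi-Lipschitz embeds into $X$. Then $X$ has the Infinite Sprawling Tree Property and thus fails the Slice PCP. In particular, if $c_0$ bi-Lipschitz embeds into a separable Banach space $X$, then $X$ fails the Slice PCP.
   Context: All Banach spaces are real; $B_X$ is the closed unit ball; $\omega=\{0,1,2,\dots\}$. A metric space $(M,d)$ bi-Lipschitz embeds into $X$ if there are $A,B>0$ and $f:M\to X$ with $A\,d(u,v)\le\|f(u)-f(v)\|\le B\,d(u,v)$ for all $u,v\in M$. For a finite sequence $s$ in $\{0,1\}\times\omega$ and an element $a\in\{0,1\}\times\omega$, $s\cdot a$ denotes the sequence $s$ extended by the one further term $a$ (concatenation). $X$ has the Infinite Sprawling Tree Property if there exist $\delta>0$ and $f:(\{0,1\}\times\omega)^{<\omega}\to B_X$ (defined on all finite sequences in $\{0,1\}\times\omega$, including the empty one) such that for all $s$: $f(s)=\frac12(f(s\cdot(0,n))+f(s\cdot(1,n)))$ for all $n\in\omega$, and $\|f(s\cdot(0,n))-f(s\cdot(0,m))\|\ge\delta$ for all $n\neq m$ in $\omega$. An open half-space of $X$ is a set $\{x\in X: x^*(x)>a\}$ with $x^*\in X^*$, $a\in\mathbb{R}$. $X$ has the Slice PCP (Slice Point of Continuity Property) if for any nonempty bounded subset $A$ of $X$ and any $\varepsilon>0$ there exists an open half-space $S$ such that $S\cap A\ne\emptyset$ and any $x\in S\cap A$ admits a weak neighborhood $V$ satisfying $\operatorname{diam}(V\cap A)<\varepsilon$. *)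

theory Defs
  imports "HOL-Analysis.Analysis"
begin

text \<open>
  Banach spaces are types of class \<open>banach\<close> (over the reals); a property of the space is a predicate
  on \<open>'a itself\<close>. Metric spaces that are merely embedded into a Banach space are values of the
  library type \<open>'m metric\<close>.
\<close>

definition bilipschitz_embeds :: "'m metric \<Rightarrow> 'a::real_normed_vector itself \<Rightarrow> bool" where
  "bilipschitz_embeds m (_ :: 'a itself) \<longleftrightarrow>
     (\<exists>A>0. \<exists>B>0. \<exists>f :: 'm \<Rightarrow> 'a. \<forall>u\<in>mspace m. \<forall>v\<in>mspace m.
        A * mdist m u v \<le> norm (f u - f v) \<and> norm (f u - f v) \<le> B * mdist m u v)"

text \<open>
  The type \<open>nat\<close> is discrete, so \<open>nat \<Rightarrow>\<^sub>C real\<close> is the space of all bounded real sequences with the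
  supremum norm.
\<close>

definition c0_metric :: "(nat \<Rightarrow>\<^sub>C real) metric" where
  "c0_metric = submetric euclidean_metric {x. apply_bcontfun x \<longlonglongrightarrow> 0}"

text \<open>
  A sequence in \<open>{0,1} \<times> \<omega>\<close> is a list over \<open>bool \<times> nat\<close>, with \<open>False\<close> for 0 and \<open>True\<close> for 1.
\<close>

definition infinite_sprawling_tree_property :: "'a::real_normed_vector itself \<Rightarrow> bool" where
  "infinite_sprawling_tree_property (_ :: 'a itself) \<longleftrightarrow>
     (\<exists>\<delta>>0. \<exists>f :: (bool \<times> nat) list \<Rightarrow> 'a.
        range f \<subseteq> cball 0 1 \<and>
        (\<forall>s n. f s = (1/2) *\<^sub>R (f (s @ [(False, n)]) + f (s @ [(True, n)]))) \<and>
        (\<forall>s n m. n \<noteq> m \<longrightarrow> norm (f (s @ [(False, n)]) - f (s @ [(False, m)])) \<ge> \<delta>))"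

definition open_half_space :: "'a::real_normed_vector set \<Rightarrow> bool" where
  "open_half_space S \<longleftrightarrow> (\<exists>(\<phi> :: 'a \<Rightarrow>\<^sub>L real) a. S = {x. blinfun_apply \<phi> x > a})"

text \<open>
  The initial topology of the functionals in the dual: the pullback of the product topology on
  real functions on the dual under the evaluation map.
\<close>

definition weak_topology :: "'a::real_normed_vector topology" where
  "weak_topology = pullback_topology UNIV (\<lambda>x (\<phi> :: 'a \<Rightarrow>\<^sub>L real). blinfun_apply \<phi> x) euclidean"

definition weak_neighborhood :: "'a::real_normed_vector \<Rightarrow> 'a set \<Rightarrow> bool" where
  "weak_neighborhood x V \<longleftrightarrow> (\<exists>U. openin weak_topology U \<and> x \<in> U \<and> U \<subseteq> V)"

definition slice_PCP :: "'a::real_normed_vector itself \<Rightarrow> bool" where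
  "slice_PCP (_ :: 'a itself) \<longleftrightarrow>
     (\<forall>(A :: 'a set) \<epsilon>. A \<noteq> {} \<and> bounded A \<and> \<epsilon> > 0 \<longrightarrow>
        (\<exists>S. open_half_space S \<and> S \<inter> A \<noteq> {} \<and>
           (\<forall>x \<in> S \<inter> A. \<exists>V. weak_neighborhood x V \<and> diameter (V \<inter> A) < \<epsilon>)))"

text \<open>
  Every countable metric space is isometric to one whose points are natural numbers, so that
  quantifying over \<open>nat metric\<close> captures all countable metric spaces, on whatever type.
\<close>

lemma countable_complete_metric_on_nat:
  fixes m :: "'m metric"
  assumes count: "countable (mspace m)" and compl: "mcomplete_of m"
  obtains m' :: "nat metric" and g :: "'m \<Rightarrow> nat"
  where "bij_betw g (mspace m) (mspace m')"
    and "\<And>u v. u \<in> mspace m \<Longrightarrow> v \<in> mspace m \<Longrightarrow> mdist m' (g u) (g v) = mdist m u v"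
    and "mcomplete_of m'"
proof -
  define g where "g = to_nat_on (mspace m)"
  define h where "h = inv_into (mspace m) g"
  define N where "N = g ` mspace m"
  define d where "d i j = (if i \<in> N \<and> j \<in> N then mdist m (h i) (h j) else 0)" for i j
  have inj: "inj_on g (mspace m)"
    unfolding g_def using count by (rule inj_on_to_nat_on)
  have hg: "h (g u) = u" if "u \<in> mspace m" for u
    unfolding h_def using inj that by simp
  have gh: "g (h i) = i" and hN: "h i \<in> mspace m" if "i \<in> N" for i
    using that hg unfolding N_def by auto
  interpret M: Metric_space "mspace m" "mdist m" by simp
  interpret N: Metric_space N d
  proof
    show "0 \<le> d x y" for x y by (simp add: d_def)
    show "d x y = d y x" for x y by (auto simp: d_def intro: M.commute)
    show "d x y = 0 \<longleftrightarrow> x = y" if "x \<in> N" "y \<in> N" for x y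
    proof -
      have "d x y = 0 \<longleftrightarrow> h x = h y"
        using that hN by (simp add: d_def)
      then show ?thesis using gh that by metis
    qed
    show "d x z \<le> d x y + d y z" if "x \<in> N" "y \<in> N" "z \<in> N" for x y z
      using that hN by (simp add: d_def M.triangle)
  qed
  have "N.mcomplete"
    unfolding N.mcomplete_def
  proof (intro allI impI)
    fix \<sigma> assume \<sigma>: "N.MCauchy \<sigma>"
    then have \<sigma>N: "\<sigma> n \<in> N" for n by (auto simp: N.MCauchy_def)
    have d\<sigma>: "d (\<sigma> n) (\<sigma> n') = mdist m (h (\<sigma> n)) (h (\<sigma> n'))" for n n'
      using \<sigma>N by (simp add: d_def)
    have "M.MCauchy (\<lambda>n. h (\<sigma> n))"
      using \<sigma> hN[OF \<sigma>N] unfolding M.MCauchy_def N.MCauchy_def d\<sigma> by blast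
    then obtain x where x: "limitin M.mtopology (\<lambda>n. h (\<sigma> n)) x sequentially"
      using compl unfolding mcomplete_of_def M.mcomplete_def by blast
    then have xm: "x \<in> mspace m" unfolding M.limitin_metric by blast
    then have gx: "g x \<in> N" unfolding N_def by blast
    have dx: "d (\<sigma> n) (g x) = mdist m (h (\<sigma> n)) x" for n
      using \<sigma>N gx hg[OF xm] by (simp add: d_def)
    have "limitin N.mtopology \<sigma> (g x) sequentially"
      using x gx \<sigma>N hN[OF \<sigma>N] unfolding M.limitin_metric N.limitin_metric dx by simp
    then show "\<exists>x. limitin N.mtopology \<sigma> x sequentially" by blast
  qed
  have iso: "mdist (metric (N, d)) (g u) (g v) = mdist m u v"
    if "u \<in> mspace m" "v \<in> mspace m" for u v
  proof -
    have "g u \<in> N" "g v \<in> N" using that unfolding N_def by blast+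
    then show ?thesis
      unfolding N.mdist_metric using hg that by (simp add: d_def)
  qed
  have bij: "bij_betw g (mspace m) (mspace (metric (N, d)))"
    unfolding N.mspace_metric using inj N_def by (simp add: bij_betw_def)
  have "mcomplete_of (metric (N, d))"
    using \<open>N.mcomplete\<close> by simp
  with bij iso show thesis by (rule that)
qed

lemma bilipschitz_embeds_countable_complete:
  fixes m :: "'m metric"
  assumes nat: "\<forall>m' :: nat metric. countable (mspace m') \<and> mcomplete_of m' \<longrightarrow>
                  bilipschitz_embeds m' TYPE('a::real_normed_vector)"
    and m: "countable (mspace m)" "mcomplete_of m"
  shows "bilipschitz_embeds m TYPE('a)"
proof -
  obtain g :: "'m \<Rightarrow> nat" and m' :: "nat metric"
    where bij: "bij_betw g (mspace m) (mspace m')"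
      and iso: "\<And>u v. u \<in> mspace m \<Longrightarrow> v \<in> mspace m \<Longrightarrow> mdist m' (g u) (g v) = mdist m u v"
      and "mcomplete_of m'"
    using m by (rule countable_complete_metric_on_nat) (rule that)
  then have "bilipschitz_embeds m' TYPE('a)" using nat by simp
  then obtain A B and f :: "nat \<Rightarrow> 'a" where "A > 0" "B > 0"
    and f: "\<And>i j. i \<in> mspace m' \<Longrightarrow> j \<in> mspace m' \<Longrightarrow>
      A * mdist m' i j \<le> norm (f i - f j) \<and> norm (f i - f j) \<le> B * mdist m' i j"
    unfolding bilipschitz_embeds_def by blast
  have "A * mdist m u v \<le> norm (f (g u) - f (g v)) \<and> norm (f (g u) - f (g v)) \<le> B * mdist m u v"
    if "u \<in> mspace m" "v \<in> mspace m" for u v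
    using f[of "g u" "g v"] iso[OF that] bij_betwE[OF bij] that by simp
  then have "\<forall>u\<in>mspace m. \<forall>v\<in>mspace m. A * mdist m u v \<le> norm ((f \<circ> g) u - (f \<circ> g) v)
      \<and> norm ((f \<circ> g) u - (f \<circ> g) v) \<le> B * mdist m u v"
    by simp
  with \<open>A > 0\<close> \<open>B > 0\<close> show ?thesis
    unfolding bilipschitz_embeds_def by (intro exI[of _ A] exI[of _ B] exI[of _ "f \<circ> g"] conjI)
qed

end

theory Submission
  imports Defs "HOL-Library.Sublist" "HOL-Library.Nat_Bijection"
begin

text \<open>
  Iterate the following step in \<open>c\<^sub>0\<close>, starting from the segment from \<open>0\<close> to a
  unit vector: give a segment of length \<open>l\<close> infinitely many approximate midpoints, the
  \<open>n\<close>-th one being the true midpoint plus \<open>l/2\<close> times a basis vector that has not been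
  used before. Every half is again a segment, of length \<open>l/2\<close>, and distinct midpoints
  are \<open>l/2\<close> apart. The endpoints form an infinitely branching diamond. If \<open>f\<close> maps it
  bi-Lipschitz into \<open>X\<close>, then the difference quotients of \<open>f\<close> along the segments form,
  up to a factor, an infinite sprawling tree: the quotient along a segment is the
  average of those along its two halves, however it is halved.

  The full diamond is neither closed nor contained in a countable complete space. For a
  well-founded tree \<open>T\<close> of segments, however, the endpoints of the segments in \<open>T\<close> are
  a closed subset of \<open>c\<^sub>0\<close> (\<open>closed_diamond_points\<close>), hence a countable complete
  metric space. Either hypothesis on \<open>X\<close> makes all these spaces embed into \<open>X\<close>, the
  second one simply by restriction to a subset of \<open>c\<^sub>0\<close>.

  It remains to pass from all well-founded diamonds to one infinite tree. This is a
  boundedness argument from descriptive set theory, carried out as a diagonal argument.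
  Up to translation, a sprawling tree is determined by its increments, one for each node
  and each number \<open>n\<close>. As \<open>X\<close> is separable, increments may be taken from a fixed dense
  sequence, so that finite approximations of sprawling trees are lists of natural
  numbers, and an infinite chain of approximations yields a sprawling tree
  (\<open>infinite_branch_imp_sprawling_tree\<close>). Suppose that there is no such chain. Use as
  \<open>T\<close> the tree of those segments whose successive midpoints are labelled with longer
  and longer approximations. It is well-founded, so its diamond embeds into \<open>X\<close>. Now
  choose increments one after the other: the \<open>i\<close>-th one approximates the increment of
  the embedded tree at the midpoint whose label is the list of the previous \<open>i\<close>
  choices. At every stage the list is an approximation, because it approximates a part
  of an actual tree in \<open>X\<close>, and therefore it is a legitimate label for the next stage.
  The process never ends and produces an infinite chain after all
  (\<open>admissible_tree_imp_infinite_branch\<close>).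

  A sprawling tree refutes the Slice PCP through the convex hull of its range: every
  slice of it contains a node \<open>x\<close>, and \<open>x\<close> is weakly close to averages of the left
  child \<open>(False, n)\<close> of one pair and the right child \<open>(True, m)\<close> of another, which stay
  at a fixed distance from \<open>x\<close>.

  Throughout, nodes are lists with the most recent step at the head, so that the
  children of \<open>r\<close> are \<open>(b, n) # r\<close>.
\<close>

section \<open>Sprawling trees and the Slice PCP\<close>

lemma simultaneously_convergent_subsequence:
  fixes g :: "'i \<Rightarrow> nat \<Rightarrow> real"
  assumes "finite J" "\<And>i. i \<in> J \<Longrightarrow> bounded (range (g i))"
  shows "\<exists>\<sigma>. strict_mono \<sigma> \<and> (\<forall>i\<in>J. convergent (\<lambda>n. g i (\<sigma> n)))"
  using assms
proof (induction J rule: finite_induct)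
  case empty
  show ?case using strict_mono_id by blast
next
  case (insert j J)
  then obtain \<sigma> where \<sigma>: "strict_mono \<sigma>" "\<And>i. i \<in> J \<Longrightarrow> convergent (\<lambda>n. g i (\<sigma> n))"
    by auto
  have "bounded (range (\<lambda>n. g j (\<sigma> n)))"
    using insert.prems[of j] by (auto elim: bounded_subset)
  then obtain l \<tau> where \<tau>: "strict_mono \<tau>" "((\<lambda>n. g j (\<sigma> n)) \<circ> \<tau>) \<longlonglongrightarrow> l"
    using bounded_imp_convergent_subsequence by blast
  have "convergent (\<lambda>n. g i ((\<sigma> \<circ> \<tau>) n))" if "i \<in> insert j J" for i
  proof (cases "i = j")
    case True
    then show ?thesis using \<tau>(2) by (auto simp: convergent_def o_def)
  next
    case False
    then have "convergent (\<lambda>n. g i (\<sigma> n))" using that \<sigma>(2) by auto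
    from convergent_subseq_convergent[OF this \<tau>(1)] show ?thesis by (simp add: o_def)
  qed
  moreover have "strict_mono (\<sigma> \<circ> \<tau>)" using \<sigma>(1) \<tau>(1) by (rule strict_mono_o)
  ultimately show ?case by blast
qed

text \<open>
  A bounded sequence may have no weakly convergent subsequence, but a weak neighbourhood
  involves only finitely many functionals. Along a subsequence all of these converge,
  and then consecutive differences are small for each of them.
\<close>

lemma weak_neighborhood_half_difference:
  fixes h :: "nat \<Rightarrow> 'a::real_normed_vector"
  assumes V: "weak_neighborhood x V" and h: "bounded (range h)"
  obtains n m where "n \<noteq> m" "x + (1/2) *\<^sub>R (h n - h m) \<in> V"
proof -
  define E :: "'a \<Rightarrow> ('a \<Rightarrow>\<^sub>L real) \<Rightarrow> real" where "E y \<phi> = blinfun_apply \<phi> y" for y \<phi>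
  from V obtain W where W: "open W" "E x \<in> W" "\<And>y. E y \<in> W \<Longrightarrow> y \<in> V"
    unfolding weak_neighborhood_def weak_topology_def openin_pullback_topology E_def by auto
  have "openin (product_topology (\<lambda>\<phi>. euclidean) UNIV) W"
    using W(1) by (simp add: euclidean_product_topology)
  from product_topology_open_contains_basis[OF this W(2)] obtain X where
    X: "E x \<in> (\<Pi>\<^sub>E \<phi>\<in>UNIV. X \<phi>)" "\<And>\<phi>. open (X \<phi>)" "finite {\<phi>. X \<phi> \<noteq> UNIV}"
       "(\<Pi>\<^sub>E \<phi>\<in>UNIV. X \<phi>) \<subseteq> W"
    by auto
  define J where "J = {\<phi>. X \<phi> \<noteq> UNIV}"
  have "bounded (range (\<lambda>n. blinfun_apply \<phi> (h n)))" for \<phi>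
    using bounded_linear_image[OF h blinfun.bounded_linear_right[of \<phi>]] by (simp add: image_image)
  then obtain \<sigma> where \<sigma>: "strict_mono \<sigma>"
      "\<And>\<phi>. \<phi> \<in> J \<Longrightarrow> convergent (\<lambda>n. blinfun_apply \<phi> (h (\<sigma> n)))"
    using simultaneously_convergent_subsequence[of J "\<lambda>\<phi> n. blinfun_apply \<phi> (h n)"] X(3)
    unfolding J_def by auto
  define y where "y n = x + (1/2) *\<^sub>R (h (\<sigma> (Suc n)) - h (\<sigma> n))" for n
  have ev: "\<forall>\<^sub>F n in sequentially. E (y n) \<phi> \<in> X \<phi>" if "\<phi> \<in> J" for \<phi>
  proof -
    have "convergent (\<lambda>n. blinfun_apply \<phi> (h (\<sigma> n)))" by (rule \<sigma>(2)[OF that])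
    then obtain l where l: "(\<lambda>n. blinfun_apply \<phi> (h (\<sigma> n))) \<longlonglongrightarrow> l"
      by (auto simp: convergent_def)
    have "(\<lambda>n. blinfun_apply \<phi> x
          + (1/2) * (blinfun_apply \<phi> (h (\<sigma> (Suc n))) - blinfun_apply \<phi> (h (\<sigma> n))))
        \<longlonglongrightarrow> blinfun_apply \<phi> x + (1/2) * (l - l)"
      by (intro tendsto_intros l LIMSEQ_Suc[OF l])
    then have "(\<lambda>n. E (y n) \<phi>) \<longlonglongrightarrow> E x \<phi>"
      unfolding E_def y_def by (simp add: blinfun.add_right blinfun.scaleR_right blinfun.diff_right)
    moreover have "E x \<phi> \<in> X \<phi>" using X(1) by auto
    ultimately show ?thesis using X(2) topological_tendstoD by blast
  qed
  have "\<forall>\<^sub>F n in sequentially. \<forall>\<phi>\<in>J. E (y n) \<phi> \<in> X \<phi>"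
    by (rule eventually_ball_finite) (use X(3) ev J_def in auto)
  then obtain n where n: "\<And>\<phi>. \<phi> \<in> J \<Longrightarrow> E (y n) \<phi> \<in> X \<phi>"
    by (auto simp: eventually_sequentially)
  have "E (y n) \<phi> \<in> X \<phi>" for \<phi>
    using n[of \<phi>] by (cases "\<phi> \<in> J") (auto simp: J_def)
  then have "E (y n) \<in> W" using X(4) by auto
  then have "y n \<in> V" by (rule W(3))
  moreover have "\<sigma> (Suc n) \<noteq> \<sigma> n" using \<sigma>(1) by (metis lessI less_irrefl strict_mono_less)
  ultimately show thesis using that unfolding y_def by blast
qed

text \<open>
  The set is the convex hull of all nodes. An open half-space that misses all nodes
  misses the hull, so every slice contains a node \<open>f s\<close>. Averaging the left child of the
  \<open>n\<close>-th pair with the right child of the \<open>m\<close>-th one moves \<open>f s\<close> by half the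
  difference of two left children; this has norm at least \<open>\<delta> / 2\<close>, but can be
  made weakly small.
\<close>

theorem sprawling_tree_imp_not_slice_PCP:
  assumes "infinite_sprawling_tree_property TYPE('a::real_normed_vector)"
  shows "\<not> slice_PCP TYPE('a)"
proof
  assume PCP: "slice_PCP TYPE('a)"
  obtain \<delta> and f :: "(bool \<times> nat) list \<Rightarrow> 'a" where "\<delta> > 0"
    and range: "range f \<subseteq> cball 0 1"
    and avg: "\<And>s n. f s = (1/2) *\<^sub>R (f (s @ [(False, n)]) + f (s @ [(True, n)]))"
    and sep: "\<And>s n m. n \<noteq> m \<Longrightarrow> \<delta> \<le> norm (f (s @ [(False, n)]) - f (s @ [(False, m)]))"
    using assms unfolding infinite_sprawling_tree_property_def by metis
  define A where "A = convex hull (range f)"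
  have A: "A \<noteq> {}" "bounded A" "\<delta> / 2 > 0"
    unfolding A_def using range \<open>\<delta> > 0\<close>
    by (auto simp: bounded_convex_hull bounded_subset[OF bounded_cball])
  with PCP obtain S where "open_half_space S" "S \<inter> A \<noteq> {}"
    and small: "\<And>x. x \<in> S \<inter> A \<Longrightarrow> \<exists>V. weak_neighborhood x V \<and> diameter (V \<inter> A) < \<delta> / 2"
    unfolding slice_PCP_def by metis
  from \<open>open_half_space S\<close> obtain \<phi> and a :: real where S: "S = {x. blinfun_apply \<phi> x > a}"
    unfolding open_half_space_def by blast
  have "\<exists>s. f s \<in> S"
  proof (rule ccontr)
    assume "\<not> ?thesis"
    then have "range f \<subseteq> {x. blinfun_apply \<phi> x \<le> a}" by (auto simp: S not_less)
    moreover have "convex {x. blinfun_apply \<phi> x \<le> a}"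
      using convex_linear_vimage[of "blinfun_apply \<phi>" "{..a}"]
      by (simp add: vimage_def blinfun.bounded_linear_right bounded_linear.linear)
    ultimately have "A \<subseteq> {x. blinfun_apply \<phi> x \<le> a}"
      unfolding A_def by (rule hull_minimal)
    then show False using \<open>S \<inter> A \<noteq> {}\<close> by (force simp: S)
  qed
  then obtain s where s: "f s \<in> S" by blast
  have fA: "f t \<in> A" for t unfolding A_def by (simp add: hull_inc)
  obtain V where V: "weak_neighborhood (f s) V" "diameter (V \<inter> A) < \<delta> / 2"
    using small s fA by blast
  define h where "h n = f (s @ [(False, n)])" for n
  have "bounded (range h)"
    by (rule bounded_subset[OF bounded_cball[of 0 1]]) (use range h_def in auto)
  then obtain n m where nm: "n \<noteq> m" "f s + (1/2) *\<^sub>R (h n - h m) \<in> V"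
    using V(1) weak_neighborhood_half_difference by blast
  define y where "y = f s + (1/2) *\<^sub>R (h n - h m)"
  have "y = (1/2) *\<^sub>R f (s @ [(False, n)]) + (1/2) *\<^sub>R f (s @ [(True, m)])"
    unfolding y_def h_def using avg[of s m] by (simp add: algebra_simps)
  also have "\<dots> \<in> A"
    using convexD[OF convex_convex_hull[of "range f"]] fA unfolding A_def by force
  finally have "y \<in> V \<inter> A" using nm y_def by simp
  moreover have "f s \<in> V \<inter> A"
    using V(1) fA unfolding weak_neighborhood_def by blast
  moreover have "bounded (V \<inter> A)" using A(2) by (simp add: bounded_Int)
  ultimately have "dist (f s) y \<le> diameter (V \<inter> A)"
    by (intro diameter_bounded_bound)
  moreover have "\<delta> / 2 \<le> dist (f s) y"
    using sep[OF nm(1), of s] by (simp add: y_def h_def dist_norm)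
  ultimately show False using V(2) by simp
qed

section \<open>The infinitely branching diamond in \<open>c\<^sub>0\<close>\<close>

definition unit_vec :: "nat \<Rightarrow> (nat \<Rightarrow>\<^sub>C real)" where
  "unit_vec j = Bcontfun (\<lambda>i. if i = j then 1 else 0)"

lemma apply_unit_vec [simp]: "apply_bcontfun (unit_vec j) i = (if i = j then 1 else 0)"
proof -
  have "(\<lambda>i. if i = j then 1 else 0 :: real) \<in> bcontfun"
    by (rule bcontfun_normI[where b = 1]) auto
  then show ?thesis unfolding unit_vec_def by (simp add: Bcontfun_inverse)
qed

definition fresh_coord :: "(bool \<times> nat) list \<Rightarrow> nat \<Rightarrow> nat" where
  "fresh_coord r n = Suc (to_nat (r, n))"

lemma fresh_coord_eq_iff [simp]: "fresh_coord r n = fresh_coord s m \<longleftrightarrow> r = s \<and> n = m"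
  by (simp add: fresh_coord_def)

definition bump :: "(bool \<times> nat) list \<Rightarrow> nat \<Rightarrow> (nat \<Rightarrow>\<^sub>C real)" where
  "bump r n = (1/2) ^ Suc (length r) *\<^sub>R unit_vec (fresh_coord r n)"

fun left_end right_end :: "(bool \<times> nat) list \<Rightarrow> (nat \<Rightarrow>\<^sub>C real)" where
  "left_end [] = 0"
| "right_end [] = unit_vec 0"
| "left_end ((b, n) # r) = (if b then (1/2) *\<^sub>R (left_end r + right_end r) + bump r n else left_end r)"
| "right_end ((b, n) # r) = (if b then right_end r else (1/2) *\<^sub>R (left_end r + right_end r) + bump r n)"

text \<open>
  The coordinate \<open>fresh_coord s n\<close> enters only when the segment \<open>s\<close> is split at its
  \<open>n\<close>-th midpoint, so it serves as a detector for the two halves created there.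
\<close>

lemma coordinate_nonzero_imp_descendant:
  assumes "apply_bcontfun (left_end t) (fresh_coord s n) \<noteq> 0 \<or> apply_bcontfun (right_end t) (fresh_coord s n) \<noteq> 0"
  shows "\<exists>p b. t = p @ (b, n) # s"
  using assms
proof (induction t)
  case Nil
  then show ?case by (simp add: fresh_coord_def)
next
  case (Cons a t)
  obtain b m where a: "a = (b, m)" by force
  show ?case
  proof (cases "apply_bcontfun (left_end t) (fresh_coord s n) \<noteq> 0 \<or> apply_bcontfun (right_end t) (fresh_coord s n) \<noteq> 0")
    case True
    then obtain p b where "t = p @ (b, n) # s" using Cons.IH by blast
    then have "a # t = (a # p) @ (b, n) # s" by simp
    then show ?thesis by blast
  next
    case False
    with Cons.prems have "s = t \<and> n = m"
      by (auto simp: a bump_def split: if_splits)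
    then show ?thesis using a by blast
  qed
qed

lemma coordinate_zero_of_short:
  assumes "length t \<le> length s"
  shows "apply_bcontfun (left_end t) (fresh_coord s n) = 0" "apply_bcontfun (right_end t) (fresh_coord s n) = 0"
proof -
  have "t \<noteq> p @ (b, n) # s" for p b using assms by auto
  then show "apply_bcontfun (left_end t) (fresh_coord s n) = 0" "apply_bcontfun (right_end t) (fresh_coord s n) = 0"
    using coordinate_nonzero_imp_descendant[of t s n] by blast+
qed

text \<open>
  In the supremum norm a perturbation in a coordinate where \<open>x\<close> vanishes costs nothing
  as long as it is no larger than half the length. This is why in \<open>c\<^sub>0\<close> the two
  halves of a segment really have half its length.
\<close>

lemma norm_half_plus_bump:
  assumes "norm x \<le> (1/2) ^ length r" "apply_bcontfun x (fresh_coord r n) = 0"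
  shows "norm ((1/2) *\<^sub>R x + bump r n) \<le> (1/2) ^ Suc (length r)"
    and "norm ((1/2) *\<^sub>R x - bump r n) \<le> (1/2) ^ Suc (length r)"
proof -
  have x: "\<bar>apply_bcontfun x i\<bar> \<le> (1/2) ^ length r" for i
    using norm_bounded[of x i] assms(1) by simp
  show "norm ((1/2) *\<^sub>R x + bump r n) \<le> (1/2) ^ Suc (length r)"
    by (rule norm_bound) (use x assms(2) in \<open>auto simp: bump_def\<close>)
  show "norm ((1/2) *\<^sub>R x - bump r n) \<le> (1/2) ^ Suc (length r)"
    by (rule norm_bound) (use x assms(2) in \<open>auto simp: bump_def\<close>)
qed

lemma mid_minus_left: "(1/2) *\<^sub>R (u + v) + w - u = (1/2) *\<^sub>R (v - u) + w"
  for u :: "'b::real_vector"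
proof -
  have "(1/2) *\<^sub>R u + (1/2) *\<^sub>R u = u" by (simp flip: scaleR_add_left)
  then show ?thesis by (simp add: algebra_simps)
qed

lemma right_minus_mid: "v - ((1/2) *\<^sub>R (u + v) + w) = (1/2) *\<^sub>R (v - u) - w"
  for u :: "'b::real_vector"
proof -
  have "v = (1/2) *\<^sub>R v + (1/2) *\<^sub>R v" by (simp flip: scaleR_add_left)
  then show ?thesis by (simp add: algebra_simps)
qed

lemma norm_right_minus_left_end: "norm (right_end r - left_end r) \<le> (1/2) ^ length r"
proof (induction r)
  case Nil
  show ?case by (simp, rule norm_bound) auto
next
  case (Cons a r)
  obtain b n where a: "a = (b, n)" by force
  have "apply_bcontfun (right_end r - left_end r) (fresh_coord r n) = 0"
    by (simp add: coordinate_zero_of_short)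
  from norm_half_plus_bump[OF Cons.IH this] show ?case
    by (cases b) (simp_all add: a mid_minus_left right_minus_mid)
qed

text \<open>
  Below the \<open>n\<close>-th midpoint of \<open>s\<close>, the fresh coordinate \<open>j\<close> grows linearly from the
  end \<open>e\<close> of \<open>s\<close> towards the midpoint, at the fastest rate that the norm allows. Hence
  this single coordinate bounds the distance of every descendant point from \<open>e\<close>.
\<close>

lemma descendant_coordinate:
  fixes b n s p
  defines "t \<equiv> p @ (b, n) # s" and "j \<equiv> fresh_coord s n"
    and "e \<equiv> (if b then right_end s else left_end s)" and "\<sigma> \<equiv> (if b then - 1 else 1 :: real)"
  shows "apply_bcontfun (right_end t) j - apply_bcontfun (left_end t) j = \<sigma> * (1/2) ^ length t
    \<and> norm (left_end t - e) \<le> apply_bcontfun (left_end t) j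
    \<and> norm (right_end t - e) \<le> apply_bcontfun (right_end t) j"
  unfolding t_def
proof (induction p)
  case Nil
  have "apply_bcontfun (left_end s) j = 0" "apply_bcontfun (right_end s) j = 0"
    unfolding j_def by (simp_all add: coordinate_zero_of_short)
  moreover have "norm (right_end ((b, n) # s) - left_end ((b, n) # s)) \<le> (1/2) ^ Suc (length s)"
    using norm_right_minus_left_end[of "(b, n) # s"] by simp
  ultimately show ?case
    by (cases b) (simp_all add: j_def e_def \<sigma>_def bump_def norm_minus_commute)
next
  case (Cons a p)
  obtain b' m where a: "a = (b', m)" by force
  define t where "t = p @ (b, n) # s"
  define c where "c = (1/2) *\<^sub>R (left_end t + right_end t) + bump t m"
  define l r where "l = apply_bcontfun (left_end t) j" and "r = apply_bcontfun (right_end t) j"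
  have "apply_bcontfun (bump t m) j = 0"
    by (auto simp: bump_def j_def t_def)
  then have c: "apply_bcontfun c j = (l + r) / 2"
    by (simp add: c_def l_def r_def)
  have IH: "r - l = \<sigma> * (1/2) ^ length t" "norm (left_end t - e) \<le> l" "norm (right_end t - e) \<le> r"
    using Cons.IH by (auto simp: t_def l_def r_def)
  have cl: "norm (c - left_end t) \<le> (1/2) ^ length t / 2"
    using norm_right_minus_left_end[of "(False, m) # t"] by (simp add: c_def)
  have cr: "norm (c - right_end t) \<le> (1/2) ^ length t / 2"
    using norm_right_minus_left_end[of "(True, m) # t"] by (simp add: c_def norm_minus_commute)
  have tri: "norm (c - e) \<le> norm (c - z) + norm (z - e)" for z
    using norm_triangle_ineq[of "c - z" "z - e"] by simp
  \<comment> \<open>The new midpoint is reached from \<open>e\<close> through the end of the segment that is nearer to \<open>e\<close>.\<close>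
  have "norm (c - e) \<le> apply_bcontfun c j"
  proof (cases b)
    case True
    then have "l - r = (1/2) ^ length t" using IH(1) by (simp add: \<sigma>_def)
    then show ?thesis using tri[of "right_end t"] cr IH(3) unfolding c by argo
  next
    case False
    then have "r - l = (1/2) ^ length t" using IH(1) by (simp add: \<sigma>_def)
    then show ?thesis using tri[of "left_end t"] cl IH(2) unfolding c by argo
  qed
  moreover have "r - apply_bcontfun c j = \<sigma> * (1/2) ^ length (a # t)"
    "apply_bcontfun c j - l = \<sigma> * (1/2) ^ length (a # t)"
    using IH(1) unfolding c by (simp_all add: field_simps)
  moreover have "left_end (a # t) = (if b' then c else left_end t)" "right_end (a # t) = (if b' then right_end t else c)"
    by (simp_all add: a c_def)
  moreover have "(a # p) @ (b, n) # s = a # t" by (simp add: t_def)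
  ultimately show ?case using IH(2,3) unfolding l_def r_def by presburger
qed

definition diamond_points :: "(bool \<times> nat) list set \<Rightarrow> (bool \<times> nat) list \<Rightarrow> (nat \<Rightarrow>\<^sub>C real) set" where
  "diamond_points T r = (\<Union>t \<in> {t \<in> T. suffix r t}. {left_end t, right_end t})"

lemma diamond_points_unfold:
  assumes T: "\<And>a t. a # t \<in> T \<Longrightarrow> t \<in> T" and "r \<in> T"
  shows "diamond_points T r = {left_end r, right_end r} \<union> (\<Union>a. diamond_points T (a # r))"
proof -
  have "suffix r t \<longleftrightarrow> t = r \<or> (\<exists>a. suffix (a # r) t)" for t
  proof
    assume "suffix r t"
    then obtain p where p: "t = p @ r" by (auto simp: suffix_def)
    show "t = r \<or> (\<exists>a. suffix (a # r) t)"
    proof (cases p rule: rev_cases)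
      case (snoc q a)
      then have "t = q @ a # r" using p by simp
      then show ?thesis unfolding suffix_def by blast
    qed (simp add: p)
  qed (auto simp: suffix_def)
  then have "{t \<in> T. suffix r t} = {r} \<union> (\<Union>a. {t \<in> T. suffix (a # r) t})"
    using \<open>r \<in> T\<close> by auto
  then show ?thesis unfolding diamond_points_def by simp
qed

lemma diamond_points_outside:
  assumes T: "\<And>a t. a # t \<in> T \<Longrightarrow> t \<in> T" and "r \<notin> T"
  shows "diamond_points T r = {}"
proof -
  have "p @ r \<in> T \<Longrightarrow> r \<in> T" for p
    by (induction p) (use T in auto)
  then show ?thesis using \<open>r \<notin> T\<close> by (auto simp: diamond_points_def suffix_def)
qed

text \<open>
  A point that lies below the \<open>n\<close>-th midpoint and far from both ends of the segment has
  a large \<open>n\<close>-th fresh coordinate, while all points below other midpoints have the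
  value \<open>0\<close> there.
\<close>

lemma child_coordinate:
  assumes "y \<in> diamond_points T ((b, n) # r)"
  shows "min (dist y (left_end r)) (dist y (right_end r)) \<le> apply_bcontfun y (fresh_coord r n)"
    and "m \<noteq> n \<Longrightarrow> apply_bcontfun y (fresh_coord r m) = 0"
proof -
  obtain p where p: "y = left_end (p @ (b, n) # r) \<or> y = right_end (p @ (b, n) # r)"
    using assms by (auto simp: diamond_points_def suffix_def)
  show "min (dist y (left_end r)) (dist y (right_end r)) \<le> apply_bcontfun y (fresh_coord r n)"
    using p descendant_coordinate[of p b n r]
    by (cases b) (auto simp: dist_norm min_def)
  show "apply_bcontfun y (fresh_coord r m) = 0" if "m \<noteq> n"
  proof (rule ccontr)
    assume "\<not> ?thesis"
    then obtain p' b' where "p @ (b, n) # r = p' @ (b', m) # r"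
      using p coordinate_nonzero_imp_descendant by blast
    then have "(p @ [(b, n)]) @ r = (p' @ [(b', m)]) @ r" by simp
    then have "p @ [(b, n)] = p' @ [(b', m)]" by (simp only: append_same_eq)
    then show False using that by simp
  qed
qed

text \<open>
  By induction from the leaves of \<open>T\<close> upwards. A limit point \<open>x\<close> of the points below
  \<open>r\<close> that differs from both ends of \<open>r\<close> cannot be approached through two different
  midpoints, because points near \<open>x\<close> that lie below different midpoints are separated
  by a fresh coordinate. So \<open>x\<close> is a limit of points below one midpoint, and these form
  a closed set by the induction hypothesis.
\<close>

lemma closed_diamond_points:
  assumes T: "\<And>a t. a # t \<in> T \<Longrightarrow> t \<in> T"
    and wf: "wf {(a # t, t) | a t. a # t \<in> T}"
  shows "closed (diamond_points T r)"
  using wf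
proof (induction r)
  case (less r)
  have IH: "closed (diamond_points T (a # r))" for a
  proof (cases "a # r \<in> T")
    case True
    then have "(a # r, r) \<in> {(a # t, t) | a t. a # t \<in> T}" by (cases a) simp
    then show ?thesis by (rule less)
  next
    case False
    then show ?thesis by (simp add: diamond_points_outside[OF T])
  qed
  show ?case
  proof (cases "r \<in> T")
    case False
    then show ?thesis using diamond_points_outside[OF T] by simp
  next
    case True
    note unfold = diamond_points_unfold[OF T True]
    have "x \<in> diamond_points T r" if x: "x \<in> closure (diamond_points T r)" for x
    proof (rule ccontr)
      assume nx: "x \<notin> diamond_points T r"
      then have "x \<noteq> left_end r" "x \<noteq> right_end r" by (auto simp: unfold)
      define \<rho> where "\<rho> = min (dist x (left_end r)) (dist x (right_end r)) / 4"
      have "\<rho> > 0" using \<open>x \<noteq> left_end r\<close> \<open>x \<noteq> right_end r\<close> by (simp add: \<rho>_def)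
      have \<rho>: "4 * \<rho> \<le> dist x (left_end r)" "4 * \<rho> \<le> dist x (right_end r)" by (simp_all add: \<rho>_def)
      have far: "3 * \<rho> < min (dist y (left_end r)) (dist y (right_end r))" if "dist y x < \<rho>" for y
        using \<rho> that dist_triangle[of x "left_end r" y] dist_triangle[of x "right_end r" y]
        by (simp add: dist_commute)
      have child: "\<exists>b n. y \<in> diamond_points T ((b, n) # r)" if "y \<in> diamond_points T r" "dist y x < \<rho>" for y
        using that far[OF that(2)] \<open>\<rho> > 0\<close> by (auto simp: unfold)
      obtain y0 where y0: "y0 \<in> diamond_points T r" "dist y0 x < \<rho>"
        using x \<open>\<rho> > 0\<close> unfolding closure_approachable by blast
      then obtain b0 N where N: "y0 \<in> diamond_points T ((b0, N) # r)" using child by blast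
      define C where "C = diamond_points T ((False, N) # r) \<union> diamond_points T ((True, N) # r)"
      have inC: "y \<in> C" if y: "y \<in> diamond_points T r" "dist y x < \<rho>" for y
      proof -
        obtain b n where n: "y \<in> diamond_points T ((b, n) # r)" using child[OF y] by blast
        have "n = N"
        proof (rule ccontr)
          assume "n \<noteq> N"
          then have "apply_bcontfun y0 (fresh_coord r n) = 0" using child_coordinate(2)[OF N] by simp
          moreover have "3 * \<rho> < apply_bcontfun y (fresh_coord r n)"
            using far[OF y(2)] child_coordinate(1)[OF n] by (rule less_le_trans)
          ultimately have "3 * \<rho> < dist y y0"
            using dist_bounded[of y "fresh_coord r n" y0] by (simp add: dist_real_def)
          then show False
            using y(2) y0(2) dist_triangle2[of y y0 x] \<open>\<rho> > 0\<close> by simp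
        qed
        then show ?thesis using n by (cases b) (auto simp: C_def)
      qed
      have "x \<in> closure C"
        unfolding closure_approachable
      proof (intro allI impI)
        fix e :: real assume "e > 0"
        then have "min e \<rho> > 0" using \<open>\<rho> > 0\<close> by simp
        then obtain y where "y \<in> diamond_points T r" "dist y x < min e \<rho>"
          using x unfolding closure_approachable by blast
        then show "\<exists>y\<in>C. dist y x < e" using inC by auto
      qed
      moreover have "closed C" unfolding C_def using IH by auto
      ultimately have "x \<in> C" by simp
      then show False using nx by (auto simp: unfold C_def)
    qed
    then have "closure (diamond_points T r) \<subseteq> diamond_points T r" by blast
    then show ?thesis by (simp only: closure_subset_eq)
  qed
qed

lemma countable_diamond_points: "countable (diamond_points T r)"
  unfolding diamond_points_def by (intro countable_UN) auto

text \<open>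
  A Cauchy sequence converges uniformly, and uniform limits preserve continuity and
  boundedness.
\<close>

lemma complete_bcontfun:
  "complete (UNIV :: ('b::topological_space \<Rightarrow>\<^sub>C 'c::complete_space) set)"
  unfolding complete_def
proof (intro allI impI)
  fix \<sigma> :: "nat \<Rightarrow> ('b \<Rightarrow>\<^sub>C 'c)"
  assume "(\<forall>n. \<sigma> n \<in> UNIV) \<and> Cauchy \<sigma>"
  then have "\<forall>e>0. \<exists>N. \<forall>m n x. N \<le> m \<and> N \<le> n \<and> True \<longrightarrow>
      dist (apply_bcontfun (\<sigma> m) x) (apply_bcontfun (\<sigma> n) x) < e"
    unfolding Cauchy_def by (metis dist_fun_lt_imp_dist_val_lt)
  then obtain l where "uniform_limit UNIV (\<lambda>n. apply_bcontfun (\<sigma> n)) l sequentially"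
    using uniformly_convergent_eq_cauchy[of "\<lambda>_. True" "\<lambda>n. apply_bcontfun (\<sigma> n)"]
    unfolding uniform_limit_sequentially_iff by auto
  then obtain l' where "\<sigma> \<longlonglongrightarrow> l'"
    using uniform_limit_bcontfunE sequentially_bot by metis
  then show "\<exists>l\<in>UNIV. \<sigma> \<longlonglongrightarrow> l" by blast
qed

lemma mcomplete_of_closed_bcontfun:
  fixes S :: "('b::topological_space \<Rightarrow>\<^sub>C 'c::complete_space) set"
  assumes "closed S"
  shows "mcomplete_of (submetric euclidean_metric S)"
proof -
  interpret S: Submetric UNIV dist S
    by unfold_locales auto
  have "S.sub.mcomplete"
    by (rule S.closedin_mcomplete_imp_mcomplete) (use assms in \<open>auto simp: complete_bcontfun\<close>)
  then show ?thesis by (simp add: mcomplete_of_def)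
qed

lemma diamond_points_tendsto_0:
  assumes "y \<in> diamond_points T r"
  shows "apply_bcontfun y \<longlonglongrightarrow> 0"
proof -
  have e: "apply_bcontfun (unit_vec j) \<longlonglongrightarrow> 0" for j
    by (rule tendsto_eventually)
       (use eventually_gt_at_top[of j] in \<open>auto elim: eventually_mono\<close>)
  have "apply_bcontfun (left_end t) \<longlonglongrightarrow> 0 \<and> apply_bcontfun (right_end t) \<longlonglongrightarrow> 0" for t
  proof (induction t)
    case Nil
    show ?case using e[of 0] by (simp del: apply_unit_vec)
  next
    case (Cons a t)
    obtain b n where a: "a = (b, n)" by force
    have "(\<lambda>i. 1/2 * (apply_bcontfun (left_end t) i + apply_bcontfun (right_end t) i)
        + (1/2) ^ Suc (length t) * apply_bcontfun (unit_vec (fresh_coord t n)) i)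
      \<longlonglongrightarrow> 1/2 * (0 + 0) + (1/2) ^ Suc (length t) * 0"
      by (intro tendsto_intros e) (use Cons in auto)
    then have "apply_bcontfun ((1/2) *\<^sub>R (left_end t + right_end t) + bump t n) \<longlonglongrightarrow> 0"
      by (simp add: bump_def plus_bcontfun.rep_eq scaleR_bcontfun.rep_eq del: apply_unit_vec)
    then show ?case using Cons by (cases b) (simp_all add: a)
  qed
  then show ?thesis using assms by (auto simp: diamond_points_def)
qed

lemma dist_midpoints:
  assumes "n \<noteq> m"
  shows "(1/2) ^ Suc (length r) \<le> dist (right_end ((False, n) # r)) (right_end ((False, m) # r))"
proof -
  have "apply_bcontfun (right_end ((False, n) # r)) (fresh_coord r n)
      - apply_bcontfun (right_end ((False, m) # r)) (fresh_coord r n) = (1/2) ^ Suc (length r)"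
    using assms by (simp add: bump_def)
  then show ?thesis
    using dist_bounded[of "right_end ((False, n) # r)" "fresh_coord r n" "right_end ((False, m) # r)"]
    by (simp add: dist_real_def del: right_end.simps)
qed

section \<open>Finite approximations of sprawling trees\<close>

text \<open>
  The numbering of the increments: \<open>node_index r n\<close> belongs to the \<open>n\<close>-th pair of
  children of \<open>r\<close>. Increments needed to reach \<open>r\<close> get smaller numbers, so that an
  initial segment of increments determines the nodes it describes. The number \<open>0\<close> is
  left free for the separation constant.
\<close>

fun node_index :: "(bool \<times> nat) list \<Rightarrow> nat \<Rightarrow> nat" where
  "node_index [] n = Suc (prod_encode (n, 0))"
| "node_index ((b, k) # r) n = Suc (prod_encode (n, Suc (2 * node_index r k + of_bool b)))"

lemma node_index_pos: "0 < node_index r n"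
  by (cases r) auto

lemma node_index_parent_less: "node_index r k < node_index ((b, k) # r) n"
  using le_prod_encode_2[of "Suc (2 * node_index r k + of_bool b)" n] by simp

lemma node_index_inject: "node_index r n = node_index s m \<Longrightarrow> r = s \<and> n = m"
proof (induction r arbitrary: s n m)
  case Nil
  then show ?case by (cases s) (auto simp: prod_encode_eq)
next
  case (Cons a r)
  obtain b k where a: "a = (b, k)" by force
  from Cons.prems obtain c l t where s: "s = (c, l) # t"
    by (cases s) (auto simp: a prod_encode_eq)
  have nm: "n = m" and "2 * node_index r k + of_bool b = 2 * node_index t l + of_bool c"
    using Cons.prems by (simp_all add: a s prod_encode_eq)
  then have "node_index r k = node_index t l \<and> b = c"
    by (cases b; cases c; simp; presburger)
  then show ?case using Cons.IH nm by (auto simp: a s)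
qed

text \<open>
  The tree with root \<open>0\<close> and increments \<open>h\<close>. As the two children of a pair are reached
  by opposite increments, the averaging identities hold for every choice of \<open>h\<close>, and
  only boundedness and separation remain as conditions. Up to a
  change of constants, both survive small perturbations of \<open>h\<close>.
\<close>

fun walk :: "(nat \<Rightarrow> 'a::real_normed_vector) \<Rightarrow> (bool \<times> nat) list \<Rightarrow> 'a" where
  "walk h [] = 0"
| "walk h ((b, n) # r) = walk h r + (if b then - h (node_index r n) else h (node_index r n))"

lemma walk_cong:
  "(\<And>i. i \<le> node_index r n \<Longrightarrow> h i = h' i) \<Longrightarrow> walk h ((b, n) # r) = walk h' ((b, n) # r)"
proof (induction r arbitrary: b n)
  case (Cons a r)
  obtain c k where a: "a = (c, k)" by force
  have "walk h (a # r) = walk h' (a # r)"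
    unfolding a by (rule Cons.IH, rule Cons.prems) (use node_index_parent_less[of r k c n] a in auto)
  then show ?case using Cons.prems[of "node_index (a # r) n"] by simp
qed simp

text \<open>
  Entry \<open>i > 0\<close> of the list \<open>w\<close> selects the \<open>i\<close>-th increment from the sequence \<open>d\<close>.
  Entry \<open>0\<close> fixes the separation constant, which therefore stays the same along every
  chain of extensions. The conditions are those of a sprawling tree, restricted to what
  the increments in \<open>w\<close> determine.
\<close>

definition approx :: "(nat \<Rightarrow> 'a::real_normed_vector) \<Rightarrow> nat list \<Rightarrow> bool" where
  "approx d w \<longleftrightarrow>
     (\<forall>r b n. node_index r n < length w \<longrightarrow> norm (walk (\<lambda>i. d (w ! i)) ((b, n) # r)) \<le> 1) \<and>
     (\<forall>r n m. n \<noteq> m \<and> node_index r n < length w \<and> node_index r m < length w \<longrightarrow>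
        1 / real (Suc (w ! 0)) \<le> norm (d (w ! node_index r n) - d (w ! node_index r m)))"

definition approx_ext :: "(nat \<Rightarrow> 'a::real_normed_vector) \<Rightarrow> (nat list \<times> nat list) set" where
  "approx_ext d = {(w', w). strict_prefix w w' \<and> approx d w'}"

lemma sprawling_tree_of_walk:
  fixes h :: "nat \<Rightarrow> 'a::real_normed_vector"
  assumes bound: "\<And>r. norm (walk h r) \<le> 1" and "\<delta> > 0"
    and sep: "\<And>r n m. n \<noteq> m \<Longrightarrow> \<delta> \<le> norm (h (node_index r n) - h (node_index r m))"
  shows "infinite_sprawling_tree_property TYPE('a)"
proof -
  define f :: "(bool \<times> nat) list \<Rightarrow> 'a" where "f s = walk h (rev s)" for s
  have "f s = (1/2) *\<^sub>R (f (s @ [(False, n)]) + f (s @ [(True, n)]))" for s n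
    by (simp add: f_def flip: scaleR_2)
  moreover have "\<delta> \<le> norm (f (s @ [(False, n)]) - f (s @ [(False, m)]))" if "n \<noteq> m" for s n m
    using sep[OF that] by (simp add: f_def)
  moreover have "range f \<subseteq> cball 0 1"
    using bound by (auto simp: f_def)
  ultimately show ?thesis
    unfolding infinite_sprawling_tree_property_def using \<open>\<delta> > 0\<close> by blast
qed

text \<open>
  The lists of an infinite descending chain converge to an infinite sequence of
  increments. Each condition of a sprawling tree involves finitely many increments and
  is thus inherited from a member of the chain.
\<close>

lemma infinite_branch_imp_sprawling_tree:
  fixes d :: "nat \<Rightarrow> 'a::real_normed_vector"
  assumes "\<not> wf (approx_ext d)"
  shows "infinite_sprawling_tree_property TYPE('a)"
proof -
  obtain W where W: "\<And>i. (W (Suc i), W i) \<in> approx_ext d"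
    using assms unfolding wf_iff_no_infinite_down_chain by blast
  define V where "V i = W (Suc i)" for i
  have V: "approx d (V i)" "strict_prefix (V i) (V (Suc i))" for i
    using W[of i] W[of "Suc i"] by (auto simp: V_def approx_ext_def)
  have len: "i \<le> length (V i)" for i
  proof (induction i)
    case (Suc i)
    then show ?case using prefix_length_less[OF V(2)[of i]] by simp
  qed simp
  have pre: "prefix (V i) (V j)" if "i \<le> j" for i j
    using that
  proof (induction rule: dec_induct)
    case (step j)
    then show ?case using V(2)[of j] by (meson prefix_order.dual_order.trans prefix_order.less_imp_le)
  qed simp
  define x where "x i = V (Suc i) ! i" for i
  have x: "V j ! i = x i" if "i < length (V j)" for i j
  proof -
    have i: "i < length (V (Suc i))" using len[of "Suc i"] by simp
    consider "j \<le> Suc i" | "Suc i \<le> j" by linarith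
    then show ?thesis
      using pre i that unfolding x_def by cases (metis nth_append prefix_def)+
  qed
  define h where "h i = d (x i)" for i
  have long: "i < length (V (Suc i))" for i
    using len[of "Suc i"] by simp
  have h: "d (V j ! i) = h i" if "i < length (V j)" for i j
    using x[OF that] by (simp add: h_def)
  show ?thesis
  proof (rule sprawling_tree_of_walk)
    show "norm (walk h r) \<le> 1" for r
    proof (cases r)
      case (Cons a s)
      obtain b n where a: "a = (b, n)" by force
      define j where "j = Suc (node_index s n)"
      have j: "node_index s n < length (V j)" unfolding j_def by (rule long)
      have "walk (\<lambda>i. d (V j ! i)) ((b, n) # s) = walk h ((b, n) # s)"
        by (rule walk_cong, rule h) (use j in simp)
      moreover have "norm (walk (\<lambda>i. d (V j ! i)) ((b, n) # s)) \<le> 1"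
        using V(1)[of j] j unfolding approx_def by blast
      ultimately show ?thesis by (simp only: Cons a)
    qed simp
    show "1 / real (Suc (x 0)) > 0" by simp
    show "1 / real (Suc (x 0)) \<le> norm (h (node_index r n) - h (node_index r m))" if "n \<noteq> m" for r n m
    proof -
      define j where "j = Suc (max (node_index r n) (node_index r m))"
      have j: "node_index r n < length (V j)" "node_index r m < length (V j)"
        using len[of j] by (simp_all add: j_def)
      have "V j ! 0 = x 0" by (rule x) (use j(1) in linarith)
      then show ?thesis
        using V(1)[of j] j h[OF j(1)] h[OF j(2)] that unfolding approx_def by metis
    qed
  qed
qed

section \<open>The diagonal argument\<close>

fun label :: "(bool \<times> nat) list \<Rightarrow> nat list" where
  "label [] = []"
| "label ((b, N) # r) = list_decode N"

text \<open>
  The labels along an admissible node, from the root on, are longer and longer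
  approximations. The label does not depend on the side \<open>b\<close>, so that siblings are
  admissible together.
\<close>

fun admissible :: "(nat \<Rightarrow> 'a::real_normed_vector) \<Rightarrow> (bool \<times> nat) list \<Rightarrow> bool" where
  "admissible d [] = True"
| "admissible d ((b, N) # r) = (admissible d r \<and> (list_decode N, label r) \<in> approx_ext d)"

lemma wf_admissible:
  assumes "wf (approx_ext d)"
  shows "wf {(a # t, t) | a t. a # t \<in> Collect (admissible d)}"
proof (rule wf_subset)
  show "wf (inv_image (approx_ext d) label)" using assms by (rule wf_inv_image)
qed (auto simp: inv_image_def)

text \<open>
  A node of the full tree is placed into the labelled tree: the midpoint with number
  \<open>i\<close> gets the label that consists of the entries of \<open>x\<close> before \<open>i\<close>. Distinct
  midpoints get distinct labels, as these differ in length.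
\<close>

fun relabel :: "(nat \<Rightarrow> nat) \<Rightarrow> (bool \<times> nat) list \<Rightarrow> (bool \<times> nat) list" where
  "relabel x [] = []"
| "relabel x ((b, n) # r) = (b, list_encode (map x [0..<node_index r n])) # relabel x r"

lemma relabel_cong:
  "(\<And>i. i < node_index r n \<Longrightarrow> x i = y i) \<Longrightarrow> relabel x ((b, n) # r) = relabel y ((b, n) # r)"
proof (induction r arbitrary: b n)
  case Nil
  then have "map x [0..<node_index [] n] = map y [0..<node_index [] n]"
    by (intro map_cong) auto
  then show ?case by (simp only: relabel.simps)
next
  case (Cons a r)
  obtain c k where a: "a = (c, k)" by force
  have "relabel x (a # r) = relabel y (a # r)"
    unfolding a by (rule Cons.IH, rule Cons.prems) (use node_index_parent_less[of r k c n] a in auto)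
  moreover have "map x [0..<node_index (a # r) n] = map y [0..<node_index (a # r) n]"
    using Cons.prems by (intro map_cong) auto
  ultimately show ?case by (simp only: relabel.simps)
qed

lemma strict_prefix_map_upt: "i < j \<Longrightarrow> strict_prefix (map x [0..<i]) (map x [0..<j])"
proof -
  assume "i < j"
  then have "map x [0..<j] = map x [0..<i] @ x i # map x [Suc i..<j]"
    by (metis append_Cons append_Nil list.simps(9) map_append upt_conv_Cons upt_add_eq_append le_add_diff_inverse less_imp_le_nat zero_le)
  then show ?thesis by (rule strict_prefixI')
qed

text \<open>
  Labels of a node and its ancestors are initial parts of the same sequence \<open>x\<close>, of
  increasing length, so only their being approximations is at stake.
\<close>

lemma relabel_admissible:
  assumes IH: "\<And>j. j < k \<Longrightarrow> approx d (map x [0..<j])" and "node_index r n < k"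
  shows "admissible d (relabel x ((b, n) # r))"
  using assms(2)
proof (induction r arbitrary: b n)
  case Nil
  have "strict_prefix [] (map x [0..<node_index [] n])"
    using strict_prefix_map_upt[OF node_index_pos, of x "[]" n] by (simp del: node_index.simps)
  then show ?case using IH[OF Nil] by (simp add: approx_ext_def del: node_index.simps)
next
  case (Cons a r)
  obtain c m where a: "a = (c, m)" by force
  have less: "node_index r m < node_index (a # r) n" unfolding a by (rule node_index_parent_less)
  then have "admissible d (relabel x (a # r))"
    unfolding a using Cons by (intro Cons.IH) (simp add: a)
  moreover have "strict_prefix (label (relabel x (a # r))) (map x [0..<node_index (a # r) n])"
    using strict_prefix_map_upt[OF less] by (simp add: a del: node_index.simps)
  ultimately show ?case
    using IH[OF Cons.prems] by (simp add: approx_ext_def del: node_index.simps)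
qed

text \<open>
  The entries \<open>x i\<close> are chosen by recursion: the label of the \<open>i\<close>-th midpoint consists
  of the earlier entries, and \<open>x i\<close> selects a good approximation of the increment of
  \<open>g\<close> at the midpoint with this label. The errors along a node add up to at most
  \<open>\<eta>\<close>, so \<open>walk\<close> stays \<open>\<eta>\<close>-close to the tree \<open>g\<close>, shifted to have its root at
  \<open>0\<close>. That all initial parts of \<open>x\<close> are approximations follows by induction on their
  length \<open>k\<close>: the conditions for \<open>k\<close> concern nodes whose labels are shorter than \<open>k\<close>;
  by induction these nodes are admissible, so \<open>g\<close> is bounded and separated there.
\<close>

lemma admissible_tree_imp_infinite_branch:
  fixes d :: "nat \<Rightarrow> 'a::real_normed_vector" and g :: "(bool \<times> nat) list \<Rightarrow> 'a"
  assumes dense: "\<And>x e. e > 0 \<Longrightarrow> \<exists>k. norm (d k - x) < e"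
    and bound: "\<And>r. admissible d r \<Longrightarrow> norm (g r) \<le> 1/4"
    and avg: "\<And>r N. g r = (1/2) *\<^sub>R (g ((False, N) # r) + g ((True, N) # r))"
    and "\<kappa> > 0"
    and sep: "\<And>r N N'. admissible d ((False, N) # r) \<Longrightarrow> admissible d ((False, N') # r) \<Longrightarrow> N \<noteq> N' \<Longrightarrow>
                \<kappa> \<le> norm (g ((False, N) # r) - g ((False, N') # r))"
  shows "\<not> wf (approx_ext d)"
proof -
  define \<eta> where "\<eta> = min (1/2) (\<kappa> / 4)"
  have \<eta>: "\<eta> > 0" "\<eta> \<le> 1/2" "\<eta> \<le> \<kappa> / 4" using \<open>\<kappa> > 0\<close> by (auto simp: \<eta>_def)
  obtain q where "inverse (real (Suc q)) < \<kappa> / 2"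
    using reals_Archimedean[of "\<kappa> / 2"] \<open>\<kappa> > 0\<close> by auto
  then have q: "1 / real (Suc q) \<le> \<kappa> / 2" by (simp add: inverse_eq_divide)
  define step where "step x r n = g (relabel x ((False, n) # r)) - g (relabel x r)" for x r n
  \<comment> \<open>\<open>P x i k\<close>: the number \<open>k\<close> is a good choice for entry \<open>i\<close>, given the entries of \<open>x\<close> before \<open>i\<close>.\<close>
  define P where "P x i k \<longleftrightarrow> (i = 0 \<longrightarrow> k = q) \<and>
      (\<forall>r n. node_index r n = i \<longrightarrow> norm (d k - step x r n) < \<eta> * (1/2) ^ Suc (length r))" for x i k
  have "\<exists>x. \<forall>i. P x i (x i)"
  proof (rule dependent_wellorder_choice)
    fix k :: nat and x y :: "nat \<Rightarrow> nat" and i :: nat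
    assume "\<And>j. j < i \<Longrightarrow> x j = y j"
    then have "relabel x ((False, n) # r) = relabel y ((False, n) # r)" if "node_index r n = i" for r n
      by (intro relabel_cong) (use that in simp)
    then have "step x r n = step y r n" if "node_index r n = i" for r n
      using that by (simp add: step_def del: node_index.simps)
    then show "P x i k = P y i k" unfolding P_def by auto
  next
    fix i :: nat and x :: "nat \<Rightarrow> nat"
    show "\<exists>k. P x i k"
    proof (cases "\<exists>r n. node_index r n = i")
      case True
      then obtain r n where rn: "node_index r n = i" by blast
      obtain k where "norm (d k - step x r n) < \<eta> * (1/2) ^ Suc (length r)"
        using dense[of "\<eta> * (1/2) ^ Suc (length r)" "step x r n"] \<eta>(1) by auto
      moreover have "i \<noteq> 0" using node_index_pos[of r n] rn by simp
      ultimately have "P x i k" using rn node_index_inject unfolding P_def by metis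
      then show ?thesis ..
    qed (auto simp: P_def)
  qed
  then obtain x where x: "\<And>i. P x i (x i)" by blast
  have x0: "x 0 = q" using x[of 0] by (simp add: P_def)
  define h where "h i = d (x i)" for i
  have step: "norm (h (node_index r n) - step x r n) \<le> \<eta> * (1/2) ^ Suc (length r)" for r n
    using x[of "node_index r n"] unfolding P_def h_def by (blast intro: less_imp_le)
  have close: "norm (walk h r - (g (relabel x r) - g [])) \<le> \<eta> * (1 - (1/2) ^ length r)" for r
  proof (induction r)
    case (Cons a r)
    obtain b n where a: "a = (b, n)" by force
    define \<sigma> :: real where "\<sigma> = (if b then -1 else 1)"
    have "g (relabel x (a # r)) = g (relabel x r) + \<sigma> *\<^sub>R step x r n"
    proof -
      have "2 *\<^sub>R g (relabel x r) = g (relabel x ((False, n) # r)) + g (relabel x ((True, n) # r))"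
        using avg[of "relabel x r" "list_encode (map x [0..<node_index r n])"] by simp
      then show ?thesis by (cases b) (auto simp: a \<sigma>_def step_def scaleR_2 algebra_simps)
    qed
    moreover have "walk h (a # r) = walk h r + \<sigma> *\<^sub>R h (node_index r n)"
      by (simp add: a \<sigma>_def)
    ultimately have "walk h (a # r) - (g (relabel x (a # r)) - g [])
        = (walk h r - (g (relabel x r) - g [])) + \<sigma> *\<^sub>R (h (node_index r n) - step x r n)"
      by (simp add: algebra_simps)
    also have "norm \<dots> \<le> norm (walk h r - (g (relabel x r) - g []))
        + norm (\<sigma> *\<^sub>R (h (node_index r n) - step x r n))"
      by (rule norm_triangle_ineq)
    also have "\<dots> \<le> \<eta> * (1 - (1/2) ^ length r) + \<eta> * (1/2) ^ Suc (length r)"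
      using Cons.IH step[of r n] by (intro add_mono) (auto simp: \<sigma>_def)
    also have "\<dots> = \<eta> * (1 - (1/2) ^ length (a # r))"
      by (simp add: algebra_simps)
    finally show ?case .
  qed simp
  have approx: "approx d (map x [0..<k])" for k
  proof (induction k rule: less_induct)
    case (less k)
    have admissible: "admissible d (relabel x ((b, n) # r))" if "node_index r n < k" for r b n
      using relabel_admissible less that by blast
    have nth: "d (map x [0..<k] ! i) = h i" if "i < k" for i
      using that by (simp add: h_def)
    have "norm (walk (\<lambda>i. d (map x [0..<k] ! i)) ((b, n) # r)) \<le> 1" if "node_index r n < k" for r b n
    proof -
      define w where "w = walk h ((b, n) # r)"
      define y where "y = g (relabel x ((b, n) # r))"
      have "norm (w - (y - g [])) \<le> \<eta> * (1 - (1/2) ^ length ((b, n) # r))"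
        unfolding w_def y_def by (rule close)
      also have "\<dots> \<le> \<eta> * 1" using \<eta>(1) by (intro mult_left_mono) auto
      finally have "norm (w - (y - g [])) \<le> 1/2" using \<eta>(2) by simp
      moreover have "norm y \<le> 1/4" "norm (g []) \<le> 1/4"
        unfolding y_def using bound admissible[OF that] by simp_all
      moreover have "norm w \<le> norm (w - (y - g [])) + (norm y + norm (g []))"
        using norm_triangle_ineq[of "w - (y - g [])" "y - g []"] norm_triangle_ineq4[of y "g []"]
        by simp
      ultimately have "norm w \<le> 1" by simp
      moreover have "walk (\<lambda>i. d (map x [0..<k] ! i)) ((b, n) # r) = w"
        unfolding w_def by (rule walk_cong, rule nth) (use that in simp)
      ultimately show ?thesis by simp
    qed
    moreover have "1 / real (Suc (map x [0..<k] ! 0))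
        \<le> norm (d (map x [0..<k] ! node_index r n) - d (map x [0..<k] ! node_index r m))"
      if nm: "n \<noteq> m" "node_index r n < k" "node_index r m < k" for r n m
    proof -
      have "node_index r n \<noteq> node_index r m" using node_index_inject nm(1) by blast
      then have "map x [0..<node_index r n] \<noteq> map x [0..<node_index r m]"
        by (metis diff_zero length_map length_upt)
      then have "list_encode (map x [0..<node_index r n]) \<noteq> list_encode (map x [0..<node_index r m])"
        by (simp add: list_encode_eq)
      then have "\<kappa> \<le> norm (g (relabel x ((False, n) # r)) - g (relabel x ((False, m) # r)))"
        using sep admissible[OF nm(2), of False] admissible[OF nm(3), of False] by simp
      then have "\<kappa> \<le> norm (step x r n - step x r m)" by (simp add: step_def)
      moreover have "step x r n - step x r m = (h (node_index r n) - h (node_index r m))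
          - ((h (node_index r n) - step x r n) - (h (node_index r m) - step x r m))" by simp
      ultimately have "\<kappa> \<le> norm (h (node_index r n) - h (node_index r m))
          + (norm (h (node_index r n) - step x r n) + norm (h (node_index r m) - step x r m))"
        using norm_triangle_ineq4 by (smt (verit))
      moreover have "\<eta> * (1/2) ^ Suc (length r) \<le> \<eta> * 1"
        using \<eta>(1) by (intro mult_left_mono power_le_one) auto
      ultimately have "\<kappa> / 2 \<le> norm (h (node_index r n) - h (node_index r m))"
        using step[of r n] step[of r m] \<eta>(3) by linarith
      moreover have "map x [0..<k] ! 0 = q" using nm x0 by simp
      ultimately show ?thesis using q nth nm by simp
    qed
    ultimately show ?case unfolding approx_def by simp
  qed
  have "(map x [0..<Suc i], map x [0..<i]) \<in> approx_ext d" for i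
    using approx[of "Suc i"] strict_prefix_map_upt[of i "Suc i" x] by (simp add: approx_ext_def)
  then have "\<exists>W. \<forall>i. (W (Suc i), W i) \<in> approx_ext d"
    by (intro exI[of _ "\<lambda>i. map x [0..<i]"] allI)
  then show ?thesis unfolding wf_iff_no_infinite_down_chain by blast
qed

text \<open>
  The tree consists of the difference quotients along the segments. Dividing by \<open>4 * B\<close>
  makes its norm at most \<open>1/4\<close>, which leaves room for shifting the root to \<open>0\<close> and for
  the approximation errors.
\<close>

lemma embedding_imp_infinite_branch:
  fixes d :: "nat \<Rightarrow> 'a::real_normed_vector"
  assumes dense: "\<And>x e. e > 0 \<Longrightarrow> \<exists>k. norm (d k - x) < e"
    and emb: "bilipschitz_embeds (submetric euclidean_metric (diamond_points (Collect (admissible d)) [])) TYPE('a)"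
  shows "\<not> wf (approx_ext d)"
proof -
  obtain A B and f :: "(nat \<Rightarrow>\<^sub>C real) \<Rightarrow> 'a" where "A > 0" "B > 0"
    and "\<forall>u\<in>diamond_points (Collect (admissible d)) []. \<forall>v\<in>diamond_points (Collect (admissible d)) [].
        A * dist u v \<le> norm (f u - f v) \<and> norm (f u - f v) \<le> B * dist u v"
    using emb unfolding bilipschitz_embeds_def by auto
  then have f: "A * dist u v \<le> norm (f u - f v) \<and> norm (f u - f v) \<le> B * dist u v"
    if "u \<in> diamond_points (Collect (admissible d)) []" "v \<in> diamond_points (Collect (admissible d)) []" for u v
    using that by blast
  have pts: "left_end r \<in> diamond_points (Collect (admissible d)) []" "right_end r \<in> diamond_points (Collect (admissible d)) []"
    if "admissible d r" for r
    using that by (auto simp: diamond_points_def)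
  define g where "g r = (2 ^ length r / (4 * B)) *\<^sub>R (f (right_end r) - f (left_end r))" for r
  show ?thesis
  proof (rule admissible_tree_imp_infinite_branch[OF dense])
    show "norm (g r) \<le> 1/4" if "admissible d r" for r
    proof -
      have "norm (f (right_end r) - f (left_end r)) \<le> B * dist (right_end r) (left_end r)" using f pts[OF that] by blast
      also have "\<dots> \<le> B * (1/2) ^ length r"
        using norm_right_minus_left_end[of r] \<open>B > 0\<close> by (simp add: dist_norm)
      finally have "norm (g r) \<le> (2 ^ length r / (4 * B)) * (B * (1/2) ^ length r)"
        using \<open>B > 0\<close> unfolding g_def by (simp add: divide_simps mult.commute)
      then show ?thesis using \<open>B > 0\<close> by (simp add: power_one_over)
    qed
    show "g r = (1/2) *\<^sub>R (g ((False, N) # r) + g ((True, N) # r))" for r N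
    proof -
      have "g ((False, N) # r) + g ((True, N) # r)
          = (2 * (2 ^ length r / (4 * B))) *\<^sub>R (f (right_end r) - f (left_end r))"
        by (simp add: g_def flip: scaleR_add_right)
      then show ?thesis by (simp add: g_def)
    qed
    show "A / (4 * B) > 0" using \<open>A > 0\<close> \<open>B > 0\<close> by simp
    show "A / (4 * B) \<le> norm (g ((False, N) # r) - g ((False, N') # r))"
      if "admissible d ((False, N) # r)" "admissible d ((False, N') # r)" "N \<noteq> N'" for r N N'
    proof -
      define u where "u = right_end ((False, N) # r)"
      define v where "v = right_end ((False, N') # r)"
      have "A * (1/2) ^ Suc (length r) \<le> A * dist u v"
        using dist_midpoints[OF that(3), of r] \<open>A > 0\<close> unfolding u_def v_def by (simp del: right_end.simps)
      also have "\<dots> \<le> norm (f u - f v)" using f pts that unfolding u_def v_def by blast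
      finally have "(2 ^ Suc (length r) / (4 * B)) * (A * (1/2) ^ Suc (length r))
          \<le> (2 ^ Suc (length r) / (4 * B)) * norm (f u - f v)"
        using \<open>B > 0\<close> by (intro mult_left_mono) auto
      moreover have "g ((False, N) # r) - g ((False, N') # r)
          = (2 ^ Suc (length r) / (4 * B)) *\<^sub>R (f u - f v)"
        unfolding g_def u_def v_def by (simp add: algebra_simps)
      ultimately show ?thesis using \<open>B > 0\<close> by (simp add: power_one_over)
    qed
  qed
qed

section \<open>Embeddings yield sprawling trees\<close>

lemma dense_sequence:
  assumes "separable_space (euclidean :: 'a::real_normed_vector topology)"
  obtains d :: "nat \<Rightarrow> 'a::real_normed_vector" where "\<And>x e. e > 0 \<Longrightarrow> \<exists>k. norm (d k - x) < e"
proof -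
  obtain C :: "'a set" where C: "countable C" "closure C = UNIV"
    using assms unfolding separable_space_def by auto
  have "\<exists>k. norm (from_nat_into C k - x) < e" if "e > 0" for x e
  proof -
    obtain y where "y \<in> C" "dist y x < e"
      using C(2) \<open>e > 0\<close> closure_approachable[of x C] by auto
    then show ?thesis using from_nat_into_surj[OF C(1)] by (metis dist_norm)
  qed
  then show thesis by (rule that)
qed

lemma bilipschitz_embeds_subset:
  fixes m :: "'m metric"
  assumes "bilipschitz_embeds (submetric m S) TYPE('a::real_normed_vector)" "S' \<subseteq> S"
  shows "bilipschitz_embeds (submetric m S') TYPE('a)"
proof -
  obtain A B and f :: "'m \<Rightarrow> 'a" where "A > 0" "B > 0"
    and "\<forall>u\<in>S \<inter> mspace m. \<forall>v\<in>S \<inter> mspace m.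
      A * mdist m u v \<le> norm (f u - f v) \<and> norm (f u - f v) \<le> B * mdist m u v"
    using assms(1) unfolding bilipschitz_embeds_def by auto
  then show ?thesis
    using assms(2) unfolding bilipschitz_embeds_def mspace_submetric mdist_submetric
    by (intro exI[of _ A] exI[of _ B] exI[of _ f] conjI) blast+
qed

text \<open>
  If there were no sprawling tree, the approximations would be well-founded under
  extension, and so would be the admissible nodes. An embedding of their diamond
  contradicts this well-foundedness.
\<close>

theorem diamonds_embed_imp_sprawling_tree:
  assumes "separable_space (euclidean :: 'a::real_normed_vector topology)"
    and emb: "\<And>T. (\<And>a t. a # t \<in> T \<Longrightarrow> t \<in> T) \<Longrightarrow> wf {(a # t, t) | a t. a # t \<in> T} \<Longrightarrow>
        bilipschitz_embeds (submetric euclidean_metric (diamond_points T [])) TYPE('a)"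
  shows "infinite_sprawling_tree_property TYPE('a)"
proof (rule ccontr)
  assume not: "\<not> ?thesis"
  obtain d :: "nat \<Rightarrow> 'a" where d: "\<And>x e. e > 0 \<Longrightarrow> \<exists>k. norm (d k - x) < e"
    using dense_sequence[OF assms(1)] by blast
  have wf: "wf (approx_ext d)" using infinite_branch_imp_sprawling_tree not by blast
  have "t \<in> Collect (admissible d)" if "a # t \<in> Collect (admissible d)" for a t
    using that by (cases a) simp
  then have "bilipschitz_embeds (submetric euclidean_metric (diamond_points (Collect (admissible d)) [])) TYPE('a)"
    using wf_admissible[OF wf] by (rule emb)
  then show False using embedding_imp_infinite_branch[OF d] wf by blast
qed

theorem corollary6p9:
  assumes "separable_space (euclidean :: 'a::banach topology)"
  shows "((\<forall>m :: nat metric. countable (mspace m) \<and> mcomplete_of m \<longrightarrow>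
            bilipschitz_embeds m TYPE('a)) \<longrightarrow>
          infinite_sprawling_tree_property TYPE('a) \<and> \<not> slice_PCP TYPE('a)) \<and>
         (bilipschitz_embeds c0_metric TYPE('a) \<longrightarrow> \<not> slice_PCP TYPE('a))"
proof (intro conjI impI)
  assume nat: "\<forall>m :: nat metric. countable (mspace m) \<and> mcomplete_of m \<longrightarrow>
    bilipschitz_embeds m TYPE('a)"
  show tree: "infinite_sprawling_tree_property TYPE('a)"
  proof (rule diamonds_embed_imp_sprawling_tree[OF assms])
    fix T :: "(bool \<times> nat) list set"
    assume T: "\<And>a t. a # t \<in> T \<Longrightarrow> t \<in> T" "wf {(a # t, t) | a t. a # t \<in> T}"
    show "bilipschitz_embeds (submetric euclidean_metric (diamond_points T [])) TYPE('a)"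
    proof (rule bilipschitz_embeds_countable_complete[OF nat])
      show "countable (mspace (submetric euclidean_metric (diamond_points T [])))"
        using countable_diamond_points by simp
      show "mcomplete_of (submetric euclidean_metric (diamond_points T []))"
        by (rule mcomplete_of_closed_bcontfun, rule closed_diamond_points[OF T])
    qed
  qed
  then show "\<not> slice_PCP TYPE('a)" by (rule sprawling_tree_imp_not_slice_PCP)
next
  assume c0: "bilipschitz_embeds c0_metric TYPE('a)"
  have "infinite_sprawling_tree_property TYPE('a)"
  proof (rule diamonds_embed_imp_sprawling_tree[OF assms])
    fix T :: "(bool \<times> nat) list set"
    show "bilipschitz_embeds (submetric euclidean_metric (diamond_points T [])) TYPE('a)"
      by (rule bilipschitz_embeds_subset[OF c0[unfolded c0_metric_def]])
        (auto intro: diamond_points_tendsto_0)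
  qed
  then show "\<not> slice_PCP TYPE('a)" by (rule sprawling_tree_imp_not_slice_PCP)
qed

end
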